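(* Let $n=7$ and let $\mathcal{L}(f)=\int_{[-1,1]^n}\rho_1(x_1)\rho_2(x_2)\cdots\rho_n(x_n)\,f(x_1,\dots,x_n)\,dx_1\cdots dx_n$, where each $\rho_i\ge 0$ is a symmetric weight function on $[-1,1]$ with $\int_{-1}^1\rho_i(x)\,dx=1$ and $\int_{-1}^1\rho_i(x)x^{2k+1}\,dx=0$ for every nonnegative integer $k$. Then there exists a cubature formula for $\mathcal{L}$ of degree five which uses at most $n^2+3n+1=71$ points.
   Context: A cubature formula for $\mathcal{L}$ with $N$ points is a linear functional $C(f)=\sum_{j=1}^N w_j f(\mathbf{x}^{(j)})$ with real weights $w_j$ (of any sign) and points $\mathbf{x}^{(j)}\in\mathbb{R}^n$; the points are not required to lie in the integration region. It is of degree five if $C(f)=\mathcal{L}(f)$ for every real polynomial $f$ in $n$ variables of total degree at most $5$. Symmetric means $\rho_i(-x)=\rho_i(x)$. *)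

theory Defs
  imports "HOL-Analysis.Analysis"
begin

(* Lebesgue integrals are taken with respect to the completed measure, so that weight functions
   need only be Lebesgue measurable. *)

definition product_functional :: "('n::finite \<Rightarrow> real \<Rightarrow> real) \<Rightarrow> (real ^ 'n \<Rightarrow> real) \<Rightarrow> real"
  where "product_functional \<rho> f =
    (LINT x : {x. \<forall>i. x $ i \<in> {-1..1}} | lebesgue. (\<Prod>i\<in>UNIV. \<rho> i (x $ i)) * f x)"

lemma finite_exponents: "finite {\<alpha> :: 'n::finite \<Rightarrow> nat. (\<Sum>i\<in>UNIV. \<alpha> i) \<le> d}"
proof (rule finite_subset)
  show "{\<alpha> :: 'n \<Rightarrow> nat. (\<Sum>i\<in>UNIV. \<alpha> i) \<le> d} \<subseteq> (\<Pi>\<^sub>E i\<in>UNIV. {..d})"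
  proof
    fix \<alpha> :: "'n \<Rightarrow> nat"
    assume "\<alpha> \<in> {\<alpha>. (\<Sum>i\<in>UNIV. \<alpha> i) \<le> d}"
    moreover have "\<alpha> i \<le> (\<Sum>i\<in>UNIV. \<alpha> i)" for i
      by (rule member_le_sum) auto
    ultimately show "\<alpha> \<in> (\<Pi>\<^sub>E i\<in>UNIV. {..d})"
      by (auto intro: order_trans)
  qed
qed (auto intro: finite_PiE)

(* Real polynomials in CARD('n) variables are identified with the functions they induce. The index
   set of the outer sum is finite by finite_exponents, and coefficients may be zero. *)

definition polynomial_of_degree_le :: "nat \<Rightarrow> (real ^ 'n::finite \<Rightarrow> real) \<Rightarrow> bool"
  where "polynomial_of_degree_le d f \<longleftrightarrow>
    (\<exists>c :: ('n \<Rightarrow> nat) \<Rightarrow> real. \<forall>x.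
      f x = (\<Sum>\<alpha> | (\<Sum>i\<in>UNIV. \<alpha> i) \<le> d. c \<alpha> * (\<Prod>i\<in>UNIV. (x $ i) ^ \<alpha> i)))"

definition cubature ::
  "nat \<Rightarrow> (nat \<Rightarrow> real) \<Rightarrow> (nat \<Rightarrow> real ^ 'n::finite) \<Rightarrow> (real ^ 'n \<Rightarrow> real) \<Rightarrow> real"
  where "cubature N w p f = (\<Sum>j<N. w j * f (p j))"

definition cubature_of_degree ::
  "nat \<Rightarrow> ((real ^ 'n::finite \<Rightarrow> real) \<Rightarrow> real) \<Rightarrow> nat \<Rightarrow> (nat \<Rightarrow> real) \<Rightarrow> (nat \<Rightarrow> real ^ 'n) \<Rightarrow> bool"
  where "cubature_of_degree d L N w p \<longleftrightarrow>
    (\<forall>f. polynomial_of_degree_le d f \<longrightarrow> cubature N w p f = L f)"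

end

theory Submission
  imports Defs
begin

text \<open>
  A degree-five formula only has to reproduce monomials, and if its nodes come in orbits under sign
  changes of the coordinates, then all monomials with an odd exponent are integrated to zero, as
  they are by the functional. What remains are the monomials \<open>1\<close>, \<open>x\<^sub>i\<^sup>2\<close>, \<open>x\<^sub>i\<^sup>4\<close> and
  \<open>x\<^sub>i\<^sup>2 x\<^sub>j\<^sup>2\<close>. Write \<open>m\<^sub>i\<close> and \<open>q\<^sub>i\<close> for the second and fourth moments of \<open>\<rho>\<^sub>i\<close>.

  The mixed monomials are handled by the Fano plane, in which any two of the seven coordinates lie
  on exactly one line. To each of the seven lines \<open>L\<close> attach a parameter \<open>t\<^sub>L > 0\<close>, the eight nodes
  whose coordinates are \<open>\<plusminus>sqrt (m\<^sub>i / t\<^sub>L)\<close> for \<open>i \<in> L\<close> and \<open>0\<close> elsewhere, and the total weight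
  \<open>t\<^sub>L\<^sup>2\<close>. Then the moments \<open>m\<^sub>i m\<^sub>j\<close> are correct whatever the parameters are. Along the \<open>i\<close>-th axis
  the lines contribute \<open>m\<^sub>i * (\<Sum>L\<ni>i. t\<^sub>L)\<close> to the second moment and \<open>3 m\<^sub>i\<^sup>2\<close> to the fourth one. A
  pair of nodes \<open>\<plusminus>b\<^sub>i e\<^sub>i\<close> of total weight \<open>v\<^sub>i\<close> must supply the defects
  \<open>A\<^sub>i = m\<^sub>i * (1 - (\<Sum>L\<ni>i. t\<^sub>L))\<close> and \<open>B\<^sub>i = q\<^sub>i - 3 m\<^sub>i\<^sup>2\<close>. This is possible when both vanish or
  both have the same sign (\<open>axis_pair_node\<close>). The sign of \<open>B\<^sub>i\<close> is prescribed by \<open>\<rho>\<^sub>i\<close> and may vary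
  with \<open>i\<close>; but the incidence matrix of the plane is invertible, so the line sums of \<open>t\<close> can be
  moved away from \<open>1\<close> in any direction, by an amount so small that every \<open>t\<^sub>L\<close> remains positive
  (\<open>pair_design_positive_weights\<close>). Finally the weight of the origin corrects the integral of \<open>1\<close>.
  The nodes number \<open>1 + 7 * 2 + 7 * 8 = 71\<close>.

  Nothing but the block structure of the plane enters, so the construction
  (\<open>steiner_triple_rule\<close>, \<open>steiner_triple_cubature\<close>) is carried out for an arbitrary Steiner triple
  system on the coordinates. The analytic input is that \<open>\<L>\<close> sends a monomial to the product of
  one-dimensional moments (\<open>product_functional_polynomial\<close>).
\<close>

section \<open>Products of functions of one coordinate\<close>

lemma prod_Basis_vec:
  "(\<Prod>b\<in>(Basis :: (real ^ 'n::finite) set). F b) = (\<Prod>i\<in>UNIV. F (axis i 1))"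
  by (rule prod.reindex_bij_betw[symmetric])
     (auto simp: bij_betw_def inj_on_def axis_eq_axis Basis_vec_def)

text \<open>
  The slab over a null set \<open>N\<close> is a product of \<open>N\<close> with whole lines, so its measure is a product of
  \<open>0\<close> with copies of \<open>\<infinity>\<close>, which is \<open>0\<close> in the extended nonnegative reals.
\<close>
lemma AE_lborel_component:
  fixes P :: "real \<Rightarrow> bool" and i :: "'n::finite"
  assumes "AE y in lborel. P y"
  shows "AE x :: real ^ 'n in lborel. P (x $ i)"
proof -
  obtain N where N: "{y \<in> space lborel. \<not> P y} \<subseteq> N" "N \<in> null_sets (lborel :: real measure)"
    using assms unfolding eventually_ae_filter by auto
  have [measurable]: "N \<in> sets borel"
    using N(2) by (auto simp: null_sets_def)
  define F :: "real ^ 'n \<Rightarrow> real \<Rightarrow> ennreal"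
    where "F b = (if b = axis i 1 then indicator N else (\<lambda>_. 1))" for b
  have F_meas: "F b \<in> borel_measurable borel" for b
    by (auto simp: F_def)
  have "(\<integral>\<^sup>+x. indicator N (x $ i) \<partial>(lborel :: (real ^ 'n) measure))
      = (\<integral>\<^sup>+x. (\<Prod>b\<in>Basis. F b (x \<bullet> b)) \<partial>lborel)"
    by (intro nn_integral_cong)
       (simp add: prod_Basis_vec F_def axis_eq_axis inner_axis if_distrib prod.delta
          cong: if_cong if_weak_cong, simp add: if_distribR prod.delta)
  also have "\<dots> = (\<Prod>b\<in>Basis. \<integral>\<^sup>+x. F b x \<partial>lborel)"
    by (rule nn_integral_lborel_prod) (simp_all add: F_meas)
  also have "\<dots> = 0"
    using N(2) by (intro prod_zero bexI[of _ "axis i 1"]) (auto simp: F_def axis_in_Basis_iff)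
  finally have "(\<integral>\<^sup>+x. indicator N (x $ i) \<partial>(lborel :: (real ^ 'n) measure)) = 0" .
  moreover have "(\<lambda>x :: real ^ 'n. indicator N (x $ i) :: ennreal) \<in> borel_measurable lborel"
    by (rule measurable_compose[of "\<lambda>x. x $ i" _ borel]) measurable
  ultimately have "AE x :: real ^ 'n in lborel. indicator N (x $ i) = (0 :: ennreal)"
    by (simp add: nn_integral_0_iff_AE)
  then show ?thesis
    by eventually_elim (use N(1) in \<open>auto simp: indicator_def split: if_splits\<close>)
qed

lemma lborel_integral_prod_components:
  fixes h :: "'n::finite \<Rightarrow> real \<Rightarrow> real"
  assumes h: "\<And>i. integrable lborel (h i)"
  shows "integrable lborel (\<lambda>x :: real ^ 'n. \<Prod>i\<in>UNIV. h i (x $ i))"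
    and "(\<integral>x. (\<Prod>i\<in>UNIV. h i (x $ i)) \<partial>(lborel :: (real ^ 'n) measure)) = (\<Prod>i\<in>UNIV. \<integral>y. h i y \<partial>lborel)"
proof -
  interpret product_sigma_finite "\<lambda>_ :: real ^ 'n. lborel :: real measure" ..
  define idx :: "real ^ 'n \<Rightarrow> 'n" where "idx b = (SOME i. b = axis i 1)" for b
  have idx [simp]: "idx (axis i 1) = i" for i
    by (simp add: idx_def axis_eq_axis)
  let ?T = "\<lambda>f. \<Sum>b\<in>Basis. f b *\<^sub>R b :: real ^ 'n"
  let ?P = "\<lambda>f. \<Prod>b\<in>Basis. h (idx b) (f b)"
  have [measurable]: "h i \<in> borel_measurable borel" for i
    using h[of i] by (auto dest: borel_measurable_integrable)
  have meas: "(\<lambda>x :: real ^ 'n. \<Prod>i\<in>UNIV. h i (x $ i)) \<in> borel_measurable borel"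
    by measurable
  have T: "?T \<in> measurable (\<Pi>\<^sub>M b\<in>Basis. lborel) borel"
    by measurable
  have P: "(\<Prod>i\<in>UNIV. h i (?T f $ i)) = ?P f" for f
  proof -
    have "?T f $ i = f (axis i 1)" for i
    proof -
      have "?T f $ i = ?T f \<bullet> axis i 1"
        by (simp add: inner_axis)
      also have "\<dots> = f (axis i 1)"
        by (subst inner_sum_left_Basis) (auto simp: axis_in_Basis_iff)
      finally show ?thesis .
    qed
    then show ?thesis
      by (simp add: prod_Basis_vec)
  qed
  have "integrable (\<Pi>\<^sub>M b\<in>Basis. lborel) ?P"
    by (rule product_integrable_prod) (simp_all add: h)
  then show "integrable lborel (\<lambda>x :: real ^ 'n. \<Prod>i\<in>UNIV. h i (x $ i))"
    by (subst lborel_eq, subst integrable_distr_eq[OF T meas]) (simp only: P)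
  have "(\<integral>x. (\<Prod>i\<in>UNIV. h i (x $ i)) \<partial>(lborel :: (real ^ 'n) measure)) = integral\<^sup>L (\<Pi>\<^sub>M b\<in>Basis. lborel) ?P"
    by (subst lborel_eq, subst integral_distr[OF T meas]) (simp only: P)
  also have "\<dots> = (\<Prod>b\<in>Basis. \<integral>y. h (idx b) y \<partial>lborel)"
    by (rule product_integral_prod) (simp_all add: h)
  finally show "(\<integral>x. (\<Prod>i\<in>UNIV. h i (x $ i)) \<partial>(lborel :: (real ^ 'n) measure)) = (\<Prod>i\<in>UNIV. \<integral>y. h i y \<partial>lborel)"
    by (simp add: prod_Basis_vec)
qed

text \<open>
  Measurability passes to \<open>g\<close> because every subset of a null set is measurable in the completion. This
  is needed for functions \<open>\<lambda>x. g (x $ i)\<close> with \<open>g\<close> Lebesgue measurable, since the preimage of a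
  Lebesgue set under a Borel map need not be a Lebesgue set in general.
\<close>
lemma borel_measurable_lebesgue_AE:
  fixes f g :: "'a::euclidean_space \<Rightarrow> 'b::topological_space"
  assumes f: "f \<in> borel_measurable lebesgue" and AE: "AE x in lebesgue. f x = g x"
  shows "g \<in> borel_measurable lebesgue"
proof (rule measurableI)
  fix A :: "'b set" assume A: "A \<in> sets borel"
  show "g -` A \<inter> space lebesgue \<in> sets lebesgue"
  proof (rule complete_measure.in_sets_AE)
    show "AE x in lebesgue. x \<in> f -` A \<inter> space lebesgue \<longleftrightarrow> x \<in> g -` A \<inter> space lebesgue"
      using AE by eventually_elim auto
  qed (use measurable_sets[OF f A] in \<open>auto simp: completion.complete_measure_axioms\<close>)
qed simp

text \<open>
  The completed measure on the space is not the product of the completed measures on the lines, so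
  Fubini's theorem is applied to Borel versions of the factors. By \<open>AE_lborel_component\<close> these
  change the product on a null set only.
\<close>
lemma lebesgue_integral_prod_components:
  fixes g :: "'n::finite \<Rightarrow> real \<Rightarrow> real"
  assumes g: "\<And>i. integrable lebesgue (g i)"
  shows "integrable lebesgue (\<lambda>x :: real ^ 'n. \<Prod>i\<in>UNIV. g i (x $ i))" (is "integrable _ ?g")
    and "(\<integral>x. (\<Prod>i\<in>UNIV. g i (x $ i)) \<partial>(lebesgue :: (real ^ 'n) measure)) = (\<Prod>i\<in>UNIV. \<integral>y. g i y \<partial>lebesgue)"
proof -
  have "\<forall>i. \<exists>h. h \<in> borel_measurable lborel \<and> (AE y in lborel. g i y = h y)"
    using completion_ex_borel_measurable_real[OF borel_measurable_integrable[OF g]] by blast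
  then obtain h where h_meas: "\<And>i. h i \<in> borel_measurable lborel"
    and gh: "\<And>i. AE y in lborel. g i y = h i y"
    by metis
  have g_meas: "g i \<in> borel_measurable lebesgue" for i
    using g by (rule borel_measurable_integrable)
  have h_meas': "h i \<in> borel_measurable lebesgue" for i
    using h_meas by (rule measurable_completion)
  have "integrable lebesgue (h i)" for i
    using integrable_cong_AE[OF g_meas h_meas' AE_completion[OF gh]] g by blast
  then have h: "integrable lborel (h i)" for i
    using integrable_completion[OF h_meas] by blast
  let ?h = "\<lambda>x :: real ^ 'n. \<Prod>i\<in>UNIV. h i (x $ i)"
  have "AE x :: real ^ 'n in lborel. \<forall>i\<in>UNIV. g i (x $ i) = h i (x $ i)"
    by (rule AE_finite_allI) (auto intro: AE_lborel_component gh)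
  then have AE: "AE x in lebesgue. ?h x = ?g x"
    by (intro AE_completion) (auto elim!: eventually_mono)
  have h_int: "integrable lborel ?h"
    by (rule lborel_integral_prod_components(1)[OF h])
  then have h_pm: "?h \<in> borel_measurable lborel"
    by (rule borel_measurable_integrable)
  have h_int': "integrable lebesgue ?h"
    using h_int integrable_completion[OF h_pm] by blast
  have h_pm': "?h \<in> borel_measurable lebesgue"
    using h_pm by (rule measurable_completion)
  have g_pm: "?g \<in> borel_measurable lebesgue"
    by (rule borel_measurable_lebesgue_AE[OF h_pm' AE])
  show "integrable lebesgue ?g"
    using integrable_cong_AE[OF h_pm' g_pm AE] h_int' by blast
  have "integral\<^sup>L lebesgue ?g = integral\<^sup>L lebesgue ?h"
    using integral_cong_AE[OF h_pm' g_pm AE] by simp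
  also have "\<dots> = integral\<^sup>L lborel ?h"
    by (rule integral_completion[OF h_pm])
  also have "\<dots> = (\<Prod>i\<in>UNIV. \<integral>y. h i y \<partial>lborel)"
    by (rule lborel_integral_prod_components(2)[OF h])
  also have "\<dots> = (\<Prod>i\<in>UNIV. \<integral>y. g i y \<partial>lebesgue)"
  proof (rule prod.cong[OF refl])
    fix i
    have "integral\<^sup>L lborel (h i) = integral\<^sup>L lebesgue (h i)"
      by (rule integral_completion[OF h_meas, symmetric])
    also have "\<dots> = integral\<^sup>L lebesgue (g i)"
      using integral_cong_AE[OF g_meas h_meas' AE_completion[OF gh]] by simp
    finally show "integral\<^sup>L lborel (h i) = integral\<^sup>L lebesgue (g i)" .
  qed
  finally show "integral\<^sup>L lebesgue ?g = (\<Prod>i\<in>UNIV. \<integral>y. g i y \<partial>lebesgue)" .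
qed

section \<open>The functional on polynomials\<close>

definition moment :: "(real \<Rightarrow> real) \<Rightarrow> nat \<Rightarrow> real"
  where "moment \<rho> k = (LINT x : {-1..1} | lebesgue. \<rho> x * x ^ k)"

lemma set_integrable_times_power:
  fixes \<rho> :: "real \<Rightarrow> real"
  assumes "set_integrable lebesgue {-1..1} \<rho>"
  shows "set_integrable lebesgue {-1..1} (\<lambda>x. \<rho> x * x ^ k)"
  unfolding set_integrable_def
proof (rule Bochner_Integration.integrable_bound)
  show int: "integrable lebesgue (\<lambda>x. indicator {-1..1} x *\<^sub>R \<rho> x)"
    using assms by (simp add: set_integrable_def)
  have "(\<lambda>x. x ^ k) \<in> borel_measurable (lebesgue :: real measure)"
    by (rule measurable_completion) simp
  from borel_measurable_times[OF borel_measurable_integrable[OF int] this]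
  show "(\<lambda>x. indicator {-1..1} x *\<^sub>R (\<rho> x * x ^ k)) \<in> borel_measurable lebesgue"
    by (simp add: mult.assoc)
  show "AE x in lebesgue. norm (indicator {-1..1} x *\<^sub>R (\<rho> x * x ^ k))
      \<le> norm (indicator {-1..1} x *\<^sub>R \<rho> x)"
    by (intro AE_I2)
       (auto simp: indicator_def abs_mult power_abs intro!: mult_left_le power_le_one)
qed

lemma even_moment_bounds:
  assumes "set_integrable lebesgue {-1..1} \<rho>"
    and nonneg: "\<And>x. x \<in> {-1..1} \<Longrightarrow> \<rho> x \<ge> 0"
  shows "0 \<le> moment \<rho> (2 * k)" and "k \<le> l \<Longrightarrow> moment \<rho> (2 * l) \<le> moment \<rho> (2 * k)"
proof -
  show "0 \<le> moment \<rho> (2 * k)"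
    unfolding moment_def set_lebesgue_integral_def
    by (rule Bochner_Integration.integral_nonneg) (auto simp: indicator_def nonneg power_mult)
  assume "k \<le> l"
  show "moment \<rho> (2 * l) \<le> moment \<rho> (2 * k)"
    unfolding moment_def
  proof (rule set_integral_mono)
    fix x :: real assume x: "x \<in> {-1..1}"
    have "(x\<^sup>2) ^ l \<le> (x\<^sup>2) ^ k"
      using x \<open>k \<le> l\<close> by (intro power_decreasing) (auto simp: abs_square_le_1[unfolded abs_le_iff])
    then show "\<rho> x * x ^ (2 * l) \<le> \<rho> x * x ^ (2 * k)"
      using nonneg[OF x] by (simp add: power_mult mult_left_mono)
  qed (simp_all add: set_integrable_times_power assms)
qed

lemma product_functional_polynomial:
  fixes \<rho> :: "'n::finite \<Rightarrow> real \<Rightarrow> real"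
  assumes \<rho>: "\<And>i. set_integrable lebesgue {-1..1} (\<rho> i)"
  shows "product_functional \<rho> (\<lambda>x. \<Sum>\<alpha>\<in>A. c \<alpha> * (\<Prod>i\<in>UNIV. (x $ i) ^ \<alpha> i))
    = (\<Sum>\<alpha>\<in>A. c \<alpha> * (\<Prod>i\<in>UNIV. moment (\<rho> i) (\<alpha> i)))"
proof -
  let ?g = "\<lambda>\<alpha> i y. indicator {-1..1} y *\<^sub>R (\<rho> i y * y ^ \<alpha> i) :: real"
  have g: "integrable lebesgue (?g \<alpha> i)" for \<alpha> i
    using set_integrable_times_power[OF \<rho>] unfolding set_integrable_def .
  have cube: "indicator {x. \<forall>i. x $ i \<in> {-1..1}} x = (\<Prod>i\<in>UNIV. indicator {-1..1} (x $ i) :: real)"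
    for x :: "real ^ 'n"
    by (auto simp: indicator_def)
  have "product_functional \<rho> (\<lambda>x. \<Sum>\<alpha>\<in>A. c \<alpha> * (\<Prod>i\<in>UNIV. (x $ i) ^ \<alpha> i))
      = (\<integral>x. (\<Sum>\<alpha>\<in>A. c \<alpha> * (\<Prod>i\<in>UNIV. ?g \<alpha> i (x $ i))) \<partial>lebesgue)"
    unfolding product_functional_def set_lebesgue_integral_def
    by (intro Bochner_Integration.integral_cong refl)
       (simp add: cube sum_distrib_left prod.distrib mult_ac del: atLeastAtMost_iff)
  also have "\<dots> = (\<Sum>\<alpha>\<in>A. c \<alpha> * (\<Prod>i\<in>UNIV. \<integral>y. ?g \<alpha> i y \<partial>lebesgue))"
  proof -
    have "integrable lebesgue (\<lambda>x :: real ^ 'n. \<Prod>i\<in>UNIV. ?g \<alpha> i (x $ i))" for \<alpha>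
      by (rule lebesgue_integral_prod_components(1)[OF g])
    moreover have "(\<integral>x. (\<Prod>i\<in>UNIV. ?g \<alpha> i (x $ i)) \<partial>(lebesgue :: (real ^ 'n) measure))
        = (\<Prod>i\<in>UNIV. \<integral>y. ?g \<alpha> i y \<partial>lebesgue)" for \<alpha>
      by (rule lebesgue_integral_prod_components(2)[OF g])
    ultimately show ?thesis
      by (subst Bochner_Integration.integral_sum) (simp_all del: real_scaleR_def)
  qed
  finally show ?thesis
    by (simp add: moment_def set_lebesgue_integral_def)
qed

text \<open>
  Both sides are linear in the polynomial, so exactness on monomials suffices. The free index type
  allows nodes to be labelled by an orbit and a sign pattern.
\<close>
lemma exists_cubature_of_degree:
  fixes \<rho> :: "'n::finite \<Rightarrow> real \<Rightarrow> real" and node :: "'j \<Rightarrow> real ^ 'n"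
  assumes \<rho>: "\<And>i. set_integrable lebesgue {-1..1} (\<rho> i)"
    and "finite J"
    and exact: "\<And>\<alpha>. (\<Sum>i\<in>UNIV. \<alpha> i) \<le> d \<Longrightarrow>
      (\<Sum>j\<in>J. w j * (\<Prod>i\<in>UNIV. (node j $ i) ^ \<alpha> i)) = (\<Prod>i\<in>UNIV. moment (\<rho> i) (\<alpha> i))"
  shows "\<exists>w p. cubature_of_degree d (product_functional \<rho>) (card J) w p"
proof -
  obtain h where h: "bij_betw h {..<card J} J"
    using ex_bij_betw_nat_finite[OF \<open>finite J\<close>] by (auto simp: atLeast0LessThan)
  have "cubature (card J) (w \<circ> h) (node \<circ> h) f = product_functional \<rho> f"
    if f: "polynomial_of_degree_le d f" for f
  proof -
    let ?A = "{\<alpha> :: 'n \<Rightarrow> nat. (\<Sum>i\<in>UNIV. \<alpha> i) \<le> d}"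
    obtain c where f_eq: "f = (\<lambda>x. \<Sum>\<alpha>\<in>?A. c \<alpha> * (\<Prod>i\<in>UNIV. (x $ i) ^ \<alpha> i))"
      using f unfolding polynomial_of_degree_le_def by (auto simp: fun_eq_iff)
    have "cubature (card J) (w \<circ> h) (node \<circ> h) f = (\<Sum>j\<in>J. w j * f (node j))"
      unfolding cubature_def using sum.reindex_bij_betw[OF h, of "\<lambda>j. w j * f (node j)"] by simp
    also have "\<dots> = (\<Sum>\<alpha>\<in>?A. c \<alpha> * (\<Sum>j\<in>J. w j * (\<Prod>i\<in>UNIV. (node j $ i) ^ \<alpha> i)))"
      by (simp add: f_eq sum_distrib_left mult_ac sum.swap[of _ _ J])
    also have "\<dots> = (\<Sum>\<alpha>\<in>?A. c \<alpha> * (\<Prod>i\<in>UNIV. moment (\<rho> i) (\<alpha> i)))"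
      by (intro sum.cong refl) (simp add: exact)
    also have "\<dots> = product_functional \<rho> f"
      unfolding f_eq by (rule product_functional_polynomial[OF \<rho>, symmetric])
    finally show ?thesis .
  qed
  then show ?thesis
    unfolding cubature_of_degree_def by blast
qed

section \<open>Sign orbits of a node\<close>

text \<open>
  Letting \<open>S\<close> range over the subsets of \<open>L\<close> produces the orbit under sign changes of the restriction
  of \<open>a\<close> to the support \<open>L\<close>. With \<open>L\<close> empty, a singleton or a line, this covers the three kinds of
  nodes uniformly. An orbit with a vanishing coordinate is counted with multiplicity.
\<close>
definition sign_flip :: "'n set \<Rightarrow> 'n set \<Rightarrow> real ^ 'n \<Rightarrow> real ^ 'n::finite"
  where "sign_flip L S a = (\<chi> i. if i \<in> S then - a $ i else if i \<in> L then a $ i else 0)"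

text \<open>
  The sum over subsets is the expansion of \<open>\<Prod>i\<in>L. (- a\<^sub>i) ^ \<alpha>\<^sub>i + a\<^sub>i ^ \<alpha>\<^sub>i\<close>. Coordinates outside
  \<open>L\<close> contribute \<open>0 ^ \<alpha>\<^sub>i\<close>, which is \<open>1\<close> off the support of \<open>\<alpha>\<close>; hence the product over the support.
\<close>
lemma sign_average_monomial:
  fixes \<alpha> :: "'n::finite \<Rightarrow> nat"
  shows "(\<Sum>S\<in>Pow L. \<Prod>i\<in>UNIV. (sign_flip L S a $ i) ^ \<alpha> i) / 2 ^ card L
    = (\<Prod>i | \<alpha> i \<noteq> 0. if i \<in> L \<and> even (\<alpha> i) then (a $ i) ^ \<alpha> i else 0)"
proof -
  let ?e = "\<lambda>i. if even (\<alpha> i) then (a $ i) ^ \<alpha> i else 0"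
  have split: "(\<Prod>i\<in>UNIV. (sign_flip L S a $ i) ^ \<alpha> i)
      = (\<Prod>i\<in>S. (- a $ i) ^ \<alpha> i) * (\<Prod>i\<in>L - S. (a $ i) ^ \<alpha> i) * (\<Prod>i\<in>- L. 0 ^ \<alpha> i)"
    if "S \<subseteq> L" for S
  proof -
    let ?f = "\<lambda>i. (sign_flip L S a $ i) ^ \<alpha> i"
    have "prod ?f UNIV = prod ?f L * prod ?f (- L)"
      using prod.union_disjoint[of L "- L" ?f] by simp
    also have "prod ?f L = prod ?f S * prod ?f (L - S)"
      using prod.subset_diff[OF that, of ?f] by (simp add: mult.commute)
    finally have "prod ?f UNIV = prod ?f S * prod ?f (L - S) * prod ?f (- L)" .
    also have "\<dots> = (\<Prod>i\<in>S. (- a $ i) ^ \<alpha> i) * (\<Prod>i\<in>L - S. (a $ i) ^ \<alpha> i) * (\<Prod>i\<in>- L. 0 ^ \<alpha> i)"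
      using that by (intro arg_cong2[of _ _ _ _ "(*)"] prod.cong) (auto simp: sign_flip_def)
    finally show ?thesis .
  qed
  have "(\<Sum>S\<in>Pow L. \<Prod>i\<in>UNIV. (sign_flip L S a $ i) ^ \<alpha> i)
      = (\<Sum>S\<in>Pow L. (\<Prod>i\<in>S. (- a $ i) ^ \<alpha> i) * (\<Prod>i\<in>L - S. (a $ i) ^ \<alpha> i)) * (\<Prod>i\<in>- L. 0 ^ \<alpha> i)"
    by (simp add: sum_distrib_right split)
  also have "\<dots> = (\<Prod>i\<in>L. (- a $ i) ^ \<alpha> i + (a $ i) ^ \<alpha> i) * (\<Prod>i\<in>- L. 0 ^ \<alpha> i)"
    by (subst prod_add) simp_all
  also have "\<dots> = (\<Prod>i\<in>L. 2 * ?e i) * (\<Prod>i\<in>- L. 0 ^ \<alpha> i)"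
    by (intro arg_cong2[of _ _ _ _ "(*)"] prod.cong) auto
  also have "\<dots> = 2 ^ card L * ((\<Prod>i\<in>L. ?e i) * (\<Prod>i\<in>- L. 0 ^ \<alpha> i))"
    by (simp add: prod.distrib)
  also have "(\<Prod>i\<in>L. ?e i) * (\<Prod>i\<in>- L. 0 ^ \<alpha> i) = (\<Prod>i\<in>UNIV. if i \<in> L then ?e i else 0 ^ \<alpha> i)"
    by (subst prod.If_cases) (auto simp: Compl_eq)
  also have "\<dots> = (\<Prod>i | \<alpha> i \<noteq> 0. if i \<in> L then ?e i else 0 ^ \<alpha> i)"
    by (intro prod.mono_neutral_right) auto
  also have "\<dots> = (\<Prod>i | \<alpha> i \<noteq> 0. if i \<in> L \<and> even (\<alpha> i) then (a $ i) ^ \<alpha> i else 0)"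
    by (intro prod.cong) auto
  finally show ?thesis
    by simp
qed

lemma even_exponent_cases:
  fixes \<alpha> :: "'n::finite \<Rightarrow> nat"
  assumes even: "\<And>i. even (\<alpha> i)" and deg: "(\<Sum>i\<in>UNIV. \<alpha> i) \<le> 5"
  obtains (zero) "{i. \<alpha> i \<noteq> 0} = {}"
    | (one) i where "{i. \<alpha> i \<noteq> 0} = {i}" "\<alpha> i = 2 \<or> \<alpha> i = 4"
    | (two) i j where "i \<noteq> j" "{i. \<alpha> i \<noteq> 0} = {i, j}" "\<alpha> i = 2" "\<alpha> j = 2"
proof -
  have ge2: "\<alpha> i \<ge> 2" if "\<alpha> i \<noteq> 0" for i
    using even[of i] that by (cases "\<alpha> i = 1") auto
  have bound: "(\<Sum>i\<in>A. \<alpha> i) \<le> 5" for A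
    using sum_mono2[of UNIV A \<alpha>] deg by simp
  show ?thesis
  proof (cases "\<exists>i. \<alpha> i \<noteq> 0")
    case False
    then show ?thesis using zero by auto
  next
    case True
    then obtain i where i: "\<alpha> i \<noteq> 0" by auto
    show ?thesis
    proof (cases "\<exists>j. j \<noteq> i \<and> \<alpha> j \<noteq> 0")
      case False
      have "\<alpha> i = 2 \<or> \<alpha> i = 4"
        using bound[of "{i}"] even[of i] i by (auto elim!: evenE)
      then show ?thesis using False i by (intro one[of i]) auto
    next
      case True
      then obtain j where j: "j \<noteq> i" "\<alpha> j \<noteq> 0" by auto
      have ij: "\<alpha> i + \<alpha> j \<le> 5"
        using bound[of "{i, j}"] j by simp
      have "\<alpha> k = 0" if "k \<noteq> i" "k \<noteq> j" for k
        using bound[of "{i, j, k}"] j that ge2[of i] ge2[of j] ge2[of k] i by fastforce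
      then have "{k. \<alpha> k \<noteq> 0} = {i, j}"
        using i j(2) by (simp add: set_eq_iff) (metis less_irrefl)
      moreover have "\<alpha> i = 2" "\<alpha> j = 2"
        using ij ge2[OF i] ge2[OF j(2)] even[of i] even[of j] by presburger+
      ultimately show ?thesis
        using j by (intro two[of i j]) auto
    qed
  qed
qed

section \<open>Prescribing line sums in a block design\<close>

text \<open>
  This is the identity \<open>N N\<^sup>T = (r - 1) I + J\<close> for the incidence matrix \<open>N\<close> of points and blocks,
  applied to the vector \<open>y\<close>. Double counting reduces it to the number of blocks through two points.
\<close>
lemma pair_design_incidence_sum:
  fixes y :: "'n::finite \<Rightarrow> real"
  assumes pairs: "\<And>i j. i \<noteq> j \<Longrightarrow> \<exists>!L. L \<in> T \<and> i \<in> L \<and> j \<in> L"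
    and deg: "\<And>i. card {L \<in> T. i \<in> L} = r"
  shows "(\<Sum>L | L \<in> T \<and> i \<in> L. \<Sum>j\<in>L. y j) = (real r - 1) * y i + (\<Sum>j\<in>UNIV. y j)"
proof -
  have card_pair: "card {L \<in> T. i \<in> L \<and> j \<in> L} = (if j = i then r else 1)" for j
  proof (cases "j = i")
    case False
    then obtain L where "{L \<in> T. i \<in> L \<and> j \<in> L} = {L}"
      using pairs[of i j] by blast
    then show ?thesis using False by simp
  qed (simp add: deg)
  have "(\<Sum>L | L \<in> T \<and> i \<in> L. \<Sum>j\<in>L. y j)
      = (\<Sum>L | L \<in> T \<and> i \<in> L. \<Sum>j | j \<in> UNIV \<and> j \<in> L. y j)"
    by simp
  also have "\<dots> = (\<Sum>j\<in>UNIV. \<Sum>L | L \<in> {L \<in> T. i \<in> L} \<and> j \<in> L. y j)"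
    by (subst sum.swap_restrict) simp_all
  also have "\<dots> = (\<Sum>j\<in>UNIV. y j + (if j = i then (real r - 1) * y i else 0))"
    by (intro sum.cong refl) (simp add: card_pair conj_assoc algebra_simps)
  finally show ?thesis
    by (simp add: sum.distrib)
qed

text \<open>
  The constant weight \<open>1 / r\<close> has all line sums equal to \<open>1\<close>. By the preceding lemma \<open>N N\<^sup>T\<close> is
  invertible, so some \<open>z\<close> of the form \<open>N\<^sup>T y\<close> has the line sums \<open>\<sigma>\<close>, and a small multiple of \<open>z\<close> can
  be added to the constant weight without losing positivity.
\<close>
lemma pair_design_positive_weights:
  fixes \<sigma> :: "'n::finite \<Rightarrow> real"
  assumes pairs: "\<And>i j. i \<noteq> j \<Longrightarrow> \<exists>!L. L \<in> T \<and> i \<in> L \<and> j \<in> L"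
    and deg: "\<And>i. card {L \<in> T. i \<in> L} = r" and "r > 1"
  shows "\<exists>\<epsilon>>0. \<exists>t. (\<forall>L\<in>T. t L > 0) \<and>
    (\<forall>i. (\<Sum>L | L \<in> T \<and> i \<in> L. t L) = 1 + \<epsilon> * \<sigma> i)"
proof -
  define n where "n = real CARD('n)"
  \<comment> \<open>\<open>\<kappa>\<close> is the value of \<open>\<Sum>i. y i\<close> that is forced by summing \<open>(r - 1) y i + (\<Sum>j. y j) = \<sigma> i\<close> over \<open>i\<close>.\<close>
  define \<kappa> where "\<kappa> = (\<Sum>i\<in>UNIV. \<sigma> i) / (real r - 1 + n)"
  define y where "y i = (\<sigma> i - \<kappa>) / (real r - 1)" for i
  define z where "z L = (\<Sum>j\<in>L. y j)" for L
  define s where "s = 1 + (\<Sum>L\<in>T. \<bar>z L\<bar>)"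
  define \<epsilon> where "\<epsilon> = 1 / (r * s)"
  define t where "t L = 1 / r + \<epsilon> * z L" for L
  have r: "real r - 1 > 0" and n: "n > 0"
    using \<open>r > 1\<close> by (simp_all add: n_def)
  have "(\<Sum>i\<in>UNIV. y i) = ((\<Sum>i\<in>UNIV. \<sigma> i) - n * \<kappa>) / (real r - 1)"
    by (simp add: y_def n_def sum_divide_distrib[symmetric] sum_subtractf)
  also have "(\<Sum>i\<in>UNIV. \<sigma> i) = \<kappa> * (real r - 1 + n)"
    using r n by (simp add: \<kappa>_def)
  also have "(\<kappa> * (real r - 1 + n) - n * \<kappa>) / (real r - 1) = \<kappa>"
    using r by (simp add: field_simps)
  finally have sum_z: "(\<Sum>L | L \<in> T \<and> i \<in> L. z L) = \<sigma> i" for i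
    unfolding z_def using r by (simp add: pair_design_incidence_sum[OF pairs deg] y_def)
  have s: "s > 0"
    unfolding s_def by (intro add_pos_nonneg sum_nonneg) simp_all
  then have "\<epsilon> > 0"
    using \<open>r > 1\<close> by (simp add: \<epsilon>_def)
  moreover have "t L > 0" if "L \<in> T" for L
  proof -
    have "- z L < s"
      using member_le_sum[of L T "\<lambda>L. \<bar>z L\<bar>"] that by (simp add: s_def)
    then have "0 < (s + z L) / (r * s)"
      using s \<open>r > 1\<close> by simp
    also have "\<dots> = t L"
      using s \<open>r > 1\<close> by (simp add: t_def \<epsilon>_def add_divide_distrib)
    finally show ?thesis .
  qed
  moreover have "(\<Sum>L | L \<in> T \<and> i \<in> L. t L) = 1 + \<epsilon> * \<sigma> i" for i
    using \<open>r > 1\<close> by (simp add: t_def sum.distrib deg sum_distrib_left[symmetric] sum_z)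
  ultimately show ?thesis
    by blast
qed

text \<open>
  Dividing the equations gives \<open>b\<^sup>2 = B / A\<close>, which is where equality of the signs is needed.
\<close>
lemma axis_pair_node:
  fixes A B :: real
  assumes "A = 0 \<Longrightarrow> B = 0" and "A \<noteq> 0 \<Longrightarrow> sgn A = sgn B"
  shows "\<exists>v b. v * b\<^sup>2 = A \<and> v * b ^ 4 = B"
proof (cases "A = 0")
  case True
  then show ?thesis using assms by (intro exI[of _ 0]) simp
next
  case False
  then have AB: "B / A > 0" "B \<noteq> 0"
    using assms(2) by (auto simp: sgn_if zero_less_divide_iff split: if_splits)
  define b where "b = sqrt (B / A)"
  have b2: "b\<^sup>2 = B / A" using AB by (simp add: b_def)
  have "b ^ 4 = (b\<^sup>2)\<^sup>2" by simp
  then have b4: "b ^ 4 = (B / A)\<^sup>2" by (simp only: b2)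
  have "A\<^sup>2 / B * b\<^sup>2 = A" "A\<^sup>2 / B * b ^ 4 = B"
    unfolding b2 b4 using AB False by (simp_all add: power2_eq_square)
  then show ?thesis by blast
qed

section \<open>The formula attached to a Steiner triple system\<close>

definition rule_blocks :: "'n set set \<Rightarrow> 'n set set"
  where "rule_blocks T = insert {} (range (\<lambda>i. {i}) \<union> T)"

lemma sum_rule_blocks:
  fixes g :: "'n::finite set \<Rightarrow> 'b::comm_monoid_add"
  assumes triples: "\<And>L. L \<in> T \<Longrightarrow> card L = 3"
  shows "sum g (rule_blocks T) = g {} + ((\<Sum>i\<in>UNIV. g {i}) + sum g T)"
proof -
  have "range (\<lambda>i. {i}) \<inter> T = {}" "{} \<notin> range (\<lambda>i. {i}) \<union> T"
    using triples by fastforce+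
  then show ?thesis
    by (simp add: rule_blocks_def sum.union_disjoint sum.reindex)
qed

text \<open>
  The number \<open>u L\<close> is the total weight of the orbit with support \<open>L\<close>, and the product is the average of
  the monomial over that orbit (\<open>sign_average_monomial\<close>). Besides the normalisation and the odd
  moments, all that matters about the moments is \<open>M i 2 \<ge> 0\<close>, so that the line nodes are real, and
  that \<open>M i 4\<close> vanishes with \<open>M i 2\<close>, so that an axis without second moment asks for nothing.
\<close>
lemma steiner_triple_rule:
  fixes M :: "'n::finite \<Rightarrow> nat \<Rightarrow> real" and T :: "'n set set"
  assumes triples: "\<And>L. L \<in> T \<Longrightarrow> card L = 3"
    and pairs: "\<And>i j. i \<noteq> j \<Longrightarrow> \<exists>!L. L \<in> T \<and> i \<in> L \<and> j \<in> L"
    and deg: "\<And>i. card {L \<in> T. i \<in> L} = r" and "r > 1"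
    and M0: "\<And>i. M i 0 = 1" and M_odd: "\<And>i k. odd k \<Longrightarrow> M i k = 0"
    and M2: "\<And>i. M i 2 \<ge> 0" and M4: "\<And>i. M i 2 = 0 \<Longrightarrow> M i 4 = 0"
  obtains u :: "'n set \<Rightarrow> real" and a :: "'n set \<Rightarrow> real ^ 'n" where
    "\<And>\<alpha>. (\<Sum>i\<in>UNIV. \<alpha> i) \<le> 5 \<Longrightarrow>
      (\<Sum>L\<in>rule_blocks T. u L * (\<Prod>i | \<alpha> i \<noteq> 0. if i \<in> L \<and> even (\<alpha> i) then (a L $ i) ^ \<alpha> i else 0))
      = (\<Prod>i\<in>UNIV. M i (\<alpha> i))"
proof -
  define B where "B i = M i 4 - real r * (M i 2)\<^sup>2" for i
  \<comment> \<open>With this choice the second-moment defect \<open>M i 2 * (1 - (\<Sum>L\<ni>i. t L))\<close> has the sign of the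
    fourth-moment defect \<open>B i\<close>.\<close>
  obtain \<epsilon> t where \<epsilon>: "\<epsilon> > 0" and t: "\<And>L. L \<in> T \<Longrightarrow> t L > 0"
    and t_sum: "\<And>i. (\<Sum>L | L \<in> T \<and> i \<in> L. t L) = 1 + \<epsilon> * (- sgn (B i))"
    using pair_design_positive_weights[OF pairs deg \<open>r > 1\<close>, where \<sigma> = "\<lambda>i. - sgn (B i)"]
    by auto
  have "\<exists>v b. v * b\<^sup>2 = M i 2 * (\<epsilon> * sgn (B i)) \<and> v * b ^ 4 = B i" for i
  proof (rule axis_pair_node)
    show "B i = 0" if "M i 2 * (\<epsilon> * sgn (B i)) = 0"
      using that \<epsilon> M4[of i] by (auto simp: B_def sgn_0_0)
    show "sgn (M i 2 * (\<epsilon> * sgn (B i))) = sgn (B i)" if "M i 2 * (\<epsilon> * sgn (B i)) \<noteq> 0"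
      using that \<epsilon> M2[of i] by (simp add: sgn_mult)
  qed
  then obtain v b where vb2: "\<And>i. v i * (b i)\<^sup>2 = M i 2 * (\<epsilon> * sgn (B i))"
    and vb4: "\<And>i. v i * b i ^ 4 = B i"
    by metis
  define u where "u L = (if L = {} then 1 - (\<Sum>i\<in>UNIV. v i) - (\<Sum>L\<in>T. (t L)\<^sup>2)
    else if L \<in> T then (t L)\<^sup>2 else v (the_elem L))" for L
  define a :: "'n set \<Rightarrow> real ^ 'n"
    where "a L = (\<chi> i. if L \<in> T then sqrt (M i 2 / t L) else b i)" for L
  have single: "{i} \<notin> T" and empty: "{} \<notin> T" for i
    using triples by fastforce+
  have u_T: "u L = (t L)\<^sup>2" if "L \<in> T" for L
    using that empty by (auto simp: u_def)
  have a2: "(a L $ i)\<^sup>2 = M i 2 / t L" if "L \<in> T" for L i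
    using that M2 t[OF that] by (simp add: a_def)
  have ta2: "(t L)\<^sup>2 * (a L $ i)\<^sup>2 = t L * M i 2"
    and ta22: "(t L)\<^sup>2 * ((a L $ i)\<^sup>2 * (a L $ j)\<^sup>2) = M i 2 * M j 2" if "L \<in> T" for L i j
    unfolding a2[OF that] using t[OF that] by (simp_all add: power2_eq_square)
  have ta4: "(t L)\<^sup>2 * a L $ i ^ 4 = (M i 2)\<^sup>2" if "L \<in> T" for L i
    using ta22[OF that, of i i] by (simp add: power2_eq_square power4_eq_xxxx mult.assoc)
  have blocks: "(\<Sum>L\<in>rule_blocks T. u L * g L)
      = u {} * g {} + ((\<Sum>i\<in>UNIV. v i * g {i}) + (\<Sum>L\<in>T. (t L)\<^sup>2 * g L))" for g
    using single by (simp add: sum_rule_blocks[OF triples] u_T) (simp add: u_def)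
  have "(\<Sum>L\<in>rule_blocks T. u L * (\<Prod>i | \<alpha> i \<noteq> 0. if i \<in> L \<and> even (\<alpha> i) then (a L $ i) ^ \<alpha> i else 0))
      = (\<Prod>i\<in>UNIV. M i (\<alpha> i))" (is "(\<Sum>L\<in>_. u L * ?P L) = _")
    if \<alpha>: "(\<Sum>i\<in>UNIV. \<alpha> i) \<le> 5" for \<alpha> :: "'n \<Rightarrow> nat"
  proof (cases "\<forall>i. even (\<alpha> i)")
    case False
    then obtain i where i: "odd (\<alpha> i)" by auto
    then have "\<alpha> i \<noteq> 0" by (auto elim: oddE)
    have "?P L = 0" for L
      using i \<open>\<alpha> i \<noteq> 0\<close> by (intro prod_zero bexI[of _ i]) auto
    moreover have "(\<Prod>i\<in>UNIV. M i (\<alpha> i)) = 0"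
      using i M_odd by (intro prod_zero bexI[of _ i]) auto
    ultimately show ?thesis
      by (simp only: mult_zero_right sum.neutral_const)
  next
    case True
    then have even: "even (\<alpha> i)" for i by simp
    have M_prod: "(\<Prod>i\<in>UNIV. M i (\<alpha> i)) = (\<Prod>i | \<alpha> i \<noteq> 0. M i (\<alpha> i))"
      by (intro prod.mono_neutral_right) (auto simp: M0)
    show ?thesis
      using even \<alpha>
    proof (cases rule: even_exponent_cases)
      case zero
      then show ?thesis
        unfolding blocks M_prod by (simp add: u_def)
    next
      case (one i)
      have P: "?P L = (if i \<in> L then (a L $ i) ^ \<alpha> i else 0)" for L
        unfolding one(1) using even by simp
      have "(\<Sum>L\<in>rule_blocks T. u L * ?P L)
          = v i * b i ^ \<alpha> i + (\<Sum>L | L \<in> T \<and> i \<in> L. (t L)\<^sup>2 * (a L $ i) ^ \<alpha> i)"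
        unfolding blocks P
        by (simp add: sum.inter_filter if_distrib cong: if_cong) (simp add: a_def single)
      also have "\<dots> = M i (\<alpha> i)"
        using one(2)
      proof
        assume 2: "\<alpha> i = 2"
        have "(\<Sum>L | L \<in> T \<and> i \<in> L. (t L)\<^sup>2 * (a L $ i)\<^sup>2) = (\<Sum>L | L \<in> T \<and> i \<in> L. t L) * M i 2"
          unfolding sum_distrib_right by (intro sum.cong refl) (simp add: ta2)
        then show ?thesis
          using 2 by (simp add: vb2 t_sum algebra_simps)
      next
        assume 4: "\<alpha> i = 4"
        have "(\<Sum>L | L \<in> T \<and> i \<in> L. (t L)\<^sup>2 * a L $ i ^ 4) = (\<Sum>L | L \<in> T \<and> i \<in> L. (M i 2)\<^sup>2)"
          by (intro sum.cong refl) (simp add: ta4)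
        then show ?thesis
          using 4 by (simp add: vb4 B_def deg)
      qed
      finally show ?thesis
        unfolding M_prod one(1) by simp
    next
      case (two i j)
      have P: "?P L = (if i \<in> L \<and> j \<in> L then (a L $ i)\<^sup>2 * (a L $ j)\<^sup>2 else 0)" for L
        unfolding two(2) using two(1,3,4) by simp
      have "(\<Sum>L\<in>rule_blocks T. u L * ?P L)
          = (\<Sum>L | L \<in> T \<and> i \<in> L \<and> j \<in> L. (t L)\<^sup>2 * ((a L $ i)\<^sup>2 * (a L $ j)\<^sup>2))"
        unfolding blocks P using two(1)
        by (auto simp: sum.inter_filter if_distrib intro!: sum.neutral cong: if_cong)
      also have "\<dots> = (\<Sum>L | L \<in> T \<and> i \<in> L \<and> j \<in> L. M i 2 * M j 2)"
        by (intro sum.cong refl) (simp add: ta22)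
      also obtain L where "{L \<in> T. i \<in> L \<and> j \<in> L} = {L}"
        using pairs[OF \<open>i \<noteq> j\<close>] by blast
      then have "(\<Sum>L | L \<in> T \<and> i \<in> L \<and> j \<in> L. M i 2 * M j 2) = M i 2 * M j 2"
        by simp
      finally show ?thesis
        unfolding M_prod two(2) using two(1,3,4) by simp
    qed
  qed
  then show ?thesis
    by (rule that)
qed

text \<open>
  Since \<open>0 \<le> x\<^sup>4 \<le> x\<^sup>2\<close> on the interval, the fourth moment vanishes whenever the second one does,
  and \<open>steiner_triple_rule\<close> applies. Each support \<open>L\<close> accounts for \<open>2 ^ card L\<close> nodes.
\<close>
theorem steiner_triple_cubature:
  fixes \<rho> :: "'n::finite \<Rightarrow> real \<Rightarrow> real" and T :: "'n set set"
  assumes triples: "\<And>L. L \<in> T \<Longrightarrow> card L = 3"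
    and pairs: "\<And>i j. i \<noteq> j \<Longrightarrow> \<exists>!L. L \<in> T \<and> i \<in> L \<and> j \<in> L"
    and deg: "\<And>i. card {L \<in> T. i \<in> L} = r" and "r > 1"
    and nonneg: "\<And>i x. x \<in> {-1..1} \<Longrightarrow> \<rho> i x \<ge> 0"
    and integrable: "\<And>i. set_integrable lebesgue {-1..1} (\<rho> i)"
    and normalized: "\<And>i. moment (\<rho> i) 0 = 1"
    and odd_moments: "\<And>i k. odd k \<Longrightarrow> moment (\<rho> i) k = 0"
  shows "\<exists>w p. cubature_of_degree 5 (product_functional \<rho>) (1 + 2 * CARD('n) + 8 * card T) w p"
proof -
  note even_moments = even_moment_bounds[OF integrable nonneg]
  have "moment (\<rho> i) 4 = 0" if "moment (\<rho> i) 2 = 0" for i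
    using even_moments(1)[of i 2] even_moments(2)[of 1 2 i] that by simp
  then obtain u a where ua: "\<And>\<alpha> :: 'n \<Rightarrow> nat. (\<Sum>i\<in>UNIV. \<alpha> i) \<le> 5 \<Longrightarrow>
      (\<Sum>L\<in>rule_blocks T. u L * (\<Prod>i | \<alpha> i \<noteq> 0. if i \<in> L \<and> even (\<alpha> i) then (a L $ i) ^ \<alpha> i else 0))
      = (\<Prod>i\<in>UNIV. moment (\<rho> i) (\<alpha> i))"
    using steiner_triple_rule[OF triples pairs deg \<open>r > 1\<close>, of "\<lambda>i. moment (\<rho> i)"]
      normalized odd_moments even_moments(1)[of _ 1] by auto
  let ?J = "Sigma (rule_blocks T) Pow"
  let ?w = "\<lambda>(L, S). u L / 2 ^ card L"
  let ?node = "\<lambda>(L, S). sign_flip L S (a L)"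
  have "(\<Sum>j\<in>?J. ?w j * (\<Prod>i\<in>UNIV. (?node j $ i) ^ \<alpha> i)) = (\<Prod>i\<in>UNIV. moment (\<rho> i) (\<alpha> i))"
    if "(\<Sum>i\<in>UNIV. \<alpha> i) \<le> 5" for \<alpha>
  proof -
    have "(\<Sum>j\<in>?J. ?w j * (\<Prod>i\<in>UNIV. (?node j $ i) ^ \<alpha> i))
        = (\<Sum>(L, S)\<in>?J. u L / 2 ^ card L * (\<Prod>i\<in>UNIV. (sign_flip L S (a L) $ i) ^ \<alpha> i))"
      by (simp add: case_prod_unfold)
    also have "\<dots> = (\<Sum>L\<in>rule_blocks T.
        u L * ((\<Sum>S\<in>Pow L. \<Prod>i\<in>UNIV. (sign_flip L S (a L) $ i) ^ \<alpha> i) / 2 ^ card L))"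
      by (subst sum.Sigma[symmetric]) (simp_all add: sum_distrib_left sum_divide_distrib)
    finally show ?thesis
      by (simp only: sign_average_monomial ua[OF that])
  qed
  from exists_cubature_of_degree[OF integrable _ this]
  have "\<exists>w p. cubature_of_degree 5 (product_functional \<rho>) (card ?J) w p"
    by simp
  moreover have "card ?J = 1 + 2 * CARD('n) + 8 * card T"
    by (simp add: card_SigmaI card_Pow sum_rule_blocks[OF triples] triples)
  ultimately show ?thesis
    by simp
qed

section \<open>The Fano plane\<close>

text \<open>
  The translates of \<open>{0, 1, 3}\<close> modulo \<open>7\<close>. This is a perfect difference set: every nonzero
  residue is a difference of two of its elements in exactly one way.
\<close>
definition fano_lines :: "7 set set"
  where "fano_lines = {{0, 1, 3}, {1, 2, 4}, {2, 3, 5}, {3, 4, 6}, {4, 5, 0}, {5, 6, 1}, {6, 0, 2}}"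

lemma UNIV_7: "(UNIV :: 7 set) = {0, 1, 2, 3, 4, 5, 6}"
  by (rule card_subset_eq[symmetric]) simp_all

lemma fano_lines_triples: "L \<in> fano_lines \<Longrightarrow> card L = 3"
  by (auto simp: fano_lines_def)

lemma card_fano_lines: "card fano_lines = 7"
  unfolding fano_lines_def by (simp add: set_eq_subset)

lemma fano_lines_through: "card {L \<in> fano_lines. i \<in> L} = 3"
proof -
  have filter_insert: "{x \<in> insert a A. P x} = (if P a then insert a {x \<in> A. P x} else {x \<in> A. P x})"
    for a :: "7 set" and A P
    by auto
  have "\<forall>i\<in>UNIV. card {L \<in> fano_lines. i \<in> L} = 3"
    unfolding UNIV_7 fano_lines_def filter_insert by (simp add: set_eq_subset)
  then show ?thesis by simp
qed

lemma fano_lines_pairs: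
  assumes "i \<noteq> j"
  shows "\<exists>!L. L \<in> fano_lines \<and> i \<in> L \<and> j \<in> L"
proof -
  have exist: "\<forall>i\<in>UNIV. \<forall>j\<in>UNIV. i \<noteq> j \<longrightarrow> (\<exists>L\<in>fano_lines. i \<in> L \<and> j \<in> L)"
    unfolding UNIV_7 fano_lines_def by simp
  have unique: "\<forall>L\<in>fano_lines. \<forall>L'\<in>fano_lines. \<forall>i\<in>L \<inter> L'. \<forall>j\<in>L \<inter> L'. i = j \<or> L = L'"
    unfolding fano_lines_def by simp
  obtain L where "L \<in> fano_lines" "i \<in> L" "j \<in> L"
    using exist assms by blast
  then show ?thesis
    using unique assms by (intro ex1I[of _ L]) auto
qed

theorem mainTheorem2:
  fixes \<rho> :: "7 \<Rightarrow> real \<Rightarrow> real"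
  assumes nonneg: "\<And>i x. x \<in> {-1..1} \<Longrightarrow> \<rho> i x \<ge> 0"
    and symmetric: "\<And>i x. x \<in> {-1..1} \<Longrightarrow> \<rho> i (- x) = \<rho> i x"
    and integrable: "\<And>i. set_integrable lebesgue {-1..1} (\<rho> i)"
    and normalized: "\<And>i. (LINT x : {-1..1} | lebesgue. \<rho> i x) = 1"
    and odd_moments: "\<And>i (k::nat). (LINT x : {-1..1} | lebesgue. \<rho> i x * x ^ (2 * k + 1)) = 0"
  shows "\<exists>N w p. N \<le> 7\<^sup>2 + 3 * 7 + 1 \<and> cubature_of_degree 5 (product_functional \<rho>) N w p"
proof -
  have "\<exists>w p. cubature_of_degree 5 (product_functional \<rho>) (1 + 2 * CARD(7) + 8 * card fano_lines) w p"
  proof (rule steiner_triple_cubature[OF fano_lines_triples fano_lines_pairs fano_lines_through _ nonneg integrable])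
    show "moment (\<rho> i) 0 = 1" for i
      using normalized[of i] by (simp add: moment_def)
    show "moment (\<rho> i) k = 0" if "odd k" for i k
      using that odd_moments[of i] by (auto simp: moment_def elim!: oddE)
  qed simp_all
  then have "\<exists>w p. cubature_of_degree 5 (product_functional \<rho>) 71 w p"
    by (simp add: card_fano_lines)
  then show ?thesis
    by (intro exI[of _ "71::nat"]) simp
qed

end
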